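(* (i) For every integer $t \ge 0$, there are exactly two inequivalent binary LCD $[6t+4,2,4t+2]$ codes. (ii) For every integer $t \ge 1$, there are exactly four inequivalent binary LCD $[6t+5,2,4t+2]$ codes.
   Context: All codes are binary linear codes; an $[n,k,d]$ code is a $k$-dimensional subspace of $\mathbb{F}_2^n$ with minimum nonzero Hamming weight $d$. A code $C$ is LCD if $C \cap C^\perp = \{\mathbf{0}_n\}$, where $C^\perp$ is the dual with respect to the standard inner product. Two binary codes are equivalent if one is obtained from the other by a permutation of coordinates. *)

theory Defs
  imports "Jordan_Normal_Form.VS_Connect" "HOL-Library.Z2" "HOL-Combinatorics.Permutations"
begin

definition hamming_weight :: "bit vec \<Rightarrow> nat" where
  "hamming_weight v = card {i. i < dim_vec v \<and> v $ i \<noteq> 0}"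

definition min_weight :: "nat \<Rightarrow> bit vec set \<Rightarrow> nat" where
  "min_weight n C = Min (hamming_weight ` (C - {0\<^sub>v n}))"

text \<open>The zero code has no minimum nonzero weight, hence is excluded for every \<open>d\<close>.\<close>

definition linear_code :: "nat \<Rightarrow> nat \<Rightarrow> nat \<Rightarrow> bit vec set \<Rightarrow> bool" where
  "linear_code n k d C \<longleftrightarrow>
     VectorSpace.subspace class_ring C (module_vec TYPE(bit) n) \<and>
     vectorspace.dim class_ring ((module_vec TYPE(bit) n)\<lparr>carrier := C\<rparr>) = k \<and>
     C \<noteq> {0\<^sub>v n} \<and> min_weight n C = d"

definition dual_code :: "nat \<Rightarrow> bit vec set \<Rightarrow> bit vec set" where
  "dual_code n C = {v \<in> carrier_vec n. \<forall>c\<in>C. v \<bullet> c = 0}"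

definition LCD_codes :: "nat \<Rightarrow> nat \<Rightarrow> nat \<Rightarrow> bit vec set set" where
  "LCD_codes n k d = {C. linear_code n k d C \<and> C \<inter> dual_code n C = {0\<^sub>v n}}"

definition permute_coords :: "(nat \<Rightarrow> nat) \<Rightarrow> bit vec \<Rightarrow> bit vec" where
  "permute_coords p v = vec (dim_vec v) (\<lambda>i. v $ p i)"

definition code_equiv :: "nat \<Rightarrow> (bit vec set \<times> bit vec set) set" where
  "code_equiv n = {(C, D). C \<subseteq> carrier_vec n \<and>
     (\<exists>p. p permutes {..<n} \<and> D = permute_coords p ` C)}"

lemma permute_coords_carrier:
  "v \<in> carrier_vec n \<Longrightarrow> permute_coords p v \<in> carrier_vec n"
  by (auto simp: permute_coords_def)

lemma permute_coords_id: "permute_coords id v = v"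
  by (auto simp: permute_coords_def)

lemma permute_coords_comp:
  assumes "v \<in> carrier_vec n" "q permutes {..<n}"
  shows "permute_coords q (permute_coords p v) = permute_coords (p \<circ> q) v"
proof (rule eq_vecI)
  fix i assume "i < dim_vec (permute_coords (p \<circ> q) v)"
  then have "i < n" using assms(1) by (simp add: permute_coords_def)
  then have "q i < n" using permutes_in_image[OF assms(2), of i] by simp
  then show "permute_coords q (permute_coords p v) $ i = permute_coords (p \<circ> q) v $ i"
    using \<open>i < n\<close> assms(1) by (simp add: permute_coords_def)
qed (simp add: permute_coords_def)

lemma equiv_code_equiv: "equiv (Pow (carrier_vec n)) (code_equiv n)"
proof (rule equivI)
  show "code_equiv n \<subseteq> Pow (carrier_vec n) \<times> Pow (carrier_vec n)"
    using permute_coords_carrier by (simp add: code_equiv_def) blast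
  show "refl_on (Pow (carrier_vec n)) (code_equiv n)"
  proof (rule refl_onI)
    fix C :: "bit vec set" assume "C \<in> Pow (carrier_vec n)"
    moreover have "C = permute_coords id ` C"
      by (simp add: permute_coords_id)
    ultimately show "(C, C) \<in> code_equiv n"
      using permutes_id unfolding code_equiv_def by blast
  qed
  show "sym (code_equiv n)"
  proof (rule symI)
    fix C D assume "(C, D) \<in> code_equiv n"
    then obtain p where p: "C \<subseteq> carrier_vec n" "p permutes {..<n}" "D = permute_coords p ` C"
      unfolding code_equiv_def by blast
    have "permute_coords (inv_into UNIV p) (permute_coords p v) = v" if "v \<in> C" for v
    proof -
      have "v \<in> carrier_vec n" using that p(1) by blast
      then show ?thesis
        by (simp only: permute_coords_comp[OF _ permutes_inv[OF p(2)]] permutes_inv_o[OF p(2)]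
            permute_coords_id)
    qed
    then have "C = permute_coords (inv_into UNIV p) ` D"
      unfolding p(3) image_image by simp
    moreover have "D \<subseteq> carrier_vec n"
      using p(1) permute_coords_carrier unfolding p(3) by blast
    ultimately show "(D, C) \<in> code_equiv n"
      using permutes_inv[OF p(2)] unfolding code_equiv_def by blast
  qed
  show "trans (code_equiv n)"
  proof (rule transI)
    fix C D E assume "(C, D) \<in> code_equiv n" "(D, E) \<in> code_equiv n"
    then obtain p q where p: "C \<subseteq> carrier_vec n" "p permutes {..<n}" "D = permute_coords p ` C"
      and q: "q permutes {..<n}" "E = permute_coords q ` D"
      unfolding code_equiv_def by blast
    have "E = permute_coords (p \<circ> q) ` C"
      unfolding q(2) p(3) image_image
      using permute_coords_comp[OF _ q(1)] p(1) by (intro image_cong refl) blast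
    then show "(C, E) \<in> code_equiv n"
      using p(1) permutes_compose[OF q(1) p(2)] unfolding code_equiv_def by blast
  qed
qed

text \<open>
  Being an LCD \<open>[n, k, d]\<close> code is invariant under coordinate permutations, so the classes of the
  quotient consist of LCD \<open>[n, k, d]\<close> codes only.
\<close>

definition num_LCD_codes :: "nat \<Rightarrow> nat \<Rightarrow> nat \<Rightarrow> nat" where
  "num_LCD_codes n k d = card (LCD_codes n k d // code_equiv n)"

end

theory Submission
  imports Defs
begin

text \<open>
  A two-dimensional code is \<open>{0, x, y, x + y}\<close>. Let \<open>a\<close>, \<open>b\<close>, \<open>c\<close> be the numbers of coordinates at which
  \<open>(x, y)\<close> equals \<open>(1, 0)\<close>, \<open>(0, 1)\<close>, \<open>(1, 1)\<close>. The nonzero weights are \<open>a + c\<close>, \<open>b + c\<close>, \<open>a + b\<close>; they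
  determine \<open>a\<close>, \<open>b\<close>, \<open>c\<close>, so two such codes are equivalent iff their multisets of weights agree.
  Changing the basis permutes \<open>a\<close>, \<open>b\<close>, \<open>c\<close>. The code is LCD iff the Gram determinant
  \<open>ab + ac + bc\<close> is odd, i.e. at most one of \<open>a\<close>, \<open>b\<close>, \<open>c\<close> is even. It remains to count the sorted
  triples \<open>a \<le> b \<le> c\<close> with this parity condition, \<open>a + b = d\<close> and \<open>a + b + c \<le> n\<close>; for
  \<open>d = 4t + 2\<close> and \<open>n \<in> {6t + 4, 6t + 5}\<close> this forces \<open>c \<le> 2t + 3\<close>.
\<close>

text \<open>As simplification rules these two would replace field addition and multiplication by bit operations.\<close>

declare add_bit_eq_xor [simp del] mult_bit_eq_and [simp del]

section \<open>Finite vector spaces and binary vectors\<close>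

text \<open>Coordinates with respect to a finite basis \<open>A\<close> put the vectors in bijection
  with the coefficient functions on \<open>A\<close>, and there are
  \<open>card (carrier K) ^ card A\<close> of these.\<close>

lemma (in vectorspace) card_carrier_eq_power_dim:
  assumes "finite (carrier K)" "finite (carrier V)"
  shows "card (carrier V) = card (carrier K) ^ dim"
proof -
  \<comment> \<open>The finite carrier is itself a finite generating set, so finite-dimensionality
    comes for free.\<close>
  have "span (carrier V) = carrier V"
    using in_own_span[of "carrier V"] span_is_subset2[of "carrier V"] by auto
  then have "fin_dim"
    unfolding fin_dim_def using assms(2) by blast
  then obtain A where A: "finite A" "basis A"
    using finite_basis_exists by blast
  then have sub: "A \<subseteq> carrier V" by (simp add: basis_def)
  then have ex1: "\<exists>!a. a \<in> A \<rightarrow>\<^sub>E carrier K \<and> lincomb a A = v" if "v \<in> carrier V" for v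
    using that basis_criterion[OF A(1) sub] A(2) by blast
  have closed: "lincomb a A \<in> carrier V" if "a \<in> A \<rightarrow>\<^sub>E carrier K" for a
    using that sub by (intro lincomb_closed) auto
  have "bij_betw (\<lambda>a. lincomb a A) (A \<rightarrow>\<^sub>E carrier K) (carrier V)"
  proof (rule bij_betw_imageI)
    show "inj_on (\<lambda>a. lincomb a A) (A \<rightarrow>\<^sub>E carrier K)"
      using ex1 closed by (intro inj_onI) blast
    show "(\<lambda>a. lincomb a A) ` (A \<rightarrow>\<^sub>E carrier K) = carrier V"
      using ex1 closed by blast
  qed
  from bij_betw_same_card[OF this] show ?thesis
    using A by (simp add: card_PiE dim_basis)
qed

lemma bit_add_self: "(a::bit) + a = 0"
  by (cases a) simp_all

lemma UNIV_bit: "(UNIV :: bit set) = {0, 1}"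
  by auto

lemma bit_vec_add_self: "v \<in> carrier_vec n \<Longrightarrow> v + v = 0\<^sub>v n" for v :: "bit vec"
  by (intro eq_vecI) (auto simp: bit_add_self)

lemma bit_vec_add_left_cancel:
  "v \<in> carrier_vec n \<Longrightarrow> w \<in> carrier_vec n \<Longrightarrow> v + (v + w) = w" for v w :: "bit vec"
  by (intro eq_vecI) (auto simp: bit_add_self simp flip: add.assoc)

lemma bit_vec_add_eq_0_iff:
  "v \<in> carrier_vec n \<Longrightarrow> w \<in> carrier_vec n \<Longrightarrow> v + w = 0\<^sub>v n \<longleftrightarrow> v = w" for v w :: "bit vec"
  by (metis bit_vec_add_left_cancel bit_vec_add_self right_zero_vec)

lemma bit_vec_add_eq_left_iff:
  "v \<in> carrier_vec n \<Longrightarrow> w \<in> carrier_vec n \<Longrightarrow> v + w = v \<longleftrightarrow> w = 0\<^sub>v n" for v w :: "bit vec"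
  by (metis bit_vec_add_left_cancel bit_vec_add_self right_zero_vec)

lemma bit_vec_add_eq_right_iff:
  "v \<in> carrier_vec n \<Longrightarrow> w \<in> carrier_vec n \<Longrightarrow> v + w = w \<longleftrightarrow> v = 0\<^sub>v n" for v w :: "bit vec"
  by (metis bit_vec_add_eq_left_iff comm_add_vec)

lemma finite_carrier_bit_vec: "finite (carrier_vec n :: bit vec set)"
proof -
  \<comment> \<open>Restricting the entry function to the valid indices places it in a finite
    function space, and \<open>vec n\<close> recovers the vector from it.\<close>
  have "carrier_vec n \<subseteq> vec n ` ({..<n} \<rightarrow>\<^sub>E (UNIV :: bit set))"
  proof
    fix v :: "bit vec" assume "v \<in> carrier_vec n"
    then have "v = vec n (restrict (($) v) {..<n})" by auto
    then show "v \<in> vec n ` ({..<n} \<rightarrow>\<^sub>E UNIV)"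
      by (intro image_eqI[where x = "restrict (($) v) {..<n}"]) auto
  qed
  moreover have "finite ({..<n} \<rightarrow>\<^sub>E (UNIV :: bit set))"
    by (intro finite_PiE) (auto simp: UNIV_bit)
  ultimately show ?thesis
    using finite_surj by blast
qed

text \<open>The only scalars are 0 and 1, so closure under scaling already follows from containing
  the zero vector.\<close>

lemma subspace_bit_iff:
  "subspace class_ring C (module_vec TYPE(bit) n) \<longleftrightarrow>
     C \<subseteq> carrier_vec n \<and> 0\<^sub>v n \<in> C \<and> (\<forall>v\<in>C. \<forall>w\<in>C. v + w \<in> C)" (is "?L \<longleftrightarrow> ?R")
proof
  assume ?L
  then have "submodule class_ring C (module_vec TYPE(bit) n)"
    by (simp add: subspace_def)
  from submodule.subset[OF this] submodule.zero_closed[OF this] submodule.m_closed[OF this]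
  show ?R by (simp add: module_vec_simps)
next
  assume R: ?R
  have "c \<cdot>\<^sub>v v \<in> C" if "v \<in> C" for c v
  proof (cases c)
    case zero
    have "v \<in> carrier_vec n" using that R by auto
    then have "0 \<cdot>\<^sub>v v = 0\<^sub>v n" by auto
    then show ?thesis using R zero by simp
  next
    case one
    then show ?thesis using that by simp
  qed
  then have "submodule class_ring C (module_vec TYPE(bit) n)"
    using R vec_module[where 'a = bit and n = n]
    by (intro submodule.intro) (auto simp: module_vec_simps)
  then show ?L
    using vec_vs[where 'a = bit and n = n] by (simp add: subspace_def)
qed

text \<open>Replaces dimension by cardinality, which is easier to handle for codes listed
  explicitly.\<close>

lemma card_bit_subspace:
  assumes "subspace class_ring C (module_vec TYPE(bit) n)"
  shows "card C = 2 ^ vectorspace.dim class_ring ((module_vec TYPE(bit) n)\<lparr>carrier := C\<rparr>)"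
proof -
  interpret vectorspace class_ring "(module_vec TYPE(bit) n)\<lparr>carrier := C\<rparr>"
    using vectorspace.subspace_is_vs[OF vec_vs assms] .
  have "finite C"
    using assms finite_carrier_bit_vec finite_subset unfolding subspace_bit_iff by blast
  then show ?thesis
    using card_carrier_eq_power_dim by (simp add: UNIV_bit class_ring_simps numeral_2_eq_2)
qed

section \<open>Two-dimensional codes as spans of two vectors\<close>

definition plane :: "nat \<Rightarrow> bit vec \<Rightarrow> bit vec \<Rightarrow> bit vec set" where
  "plane n x y = {0\<^sub>v n, x, y, x + y}"

text \<open>This is linear independence over the two-element field: the nontrivial combinations are
  \<open>x\<close>, \<open>y\<close> and \<open>x + y\<close>, and the last vanishes iff
  \<open>x = y\<close>.\<close>

definition independent_pair :: "nat \<Rightarrow> bit vec \<Rightarrow> bit vec \<Rightarrow> bool" where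
  "independent_pair n x y \<longleftrightarrow> x \<in> carrier_vec n \<and> y \<in> carrier_vec n \<and>
     x \<noteq> 0\<^sub>v n \<and> y \<noteq> 0\<^sub>v n \<and> x \<noteq> y"

lemma plane_minus_zero:
  assumes "independent_pair n x y"
  shows "plane n x y - {0\<^sub>v n} = {x, y, x + y}" "x + y \<noteq> x" "x + y \<noteq> y" "x \<noteq> y"
  using assms unfolding independent_pair_def plane_def
  by (auto simp: bit_vec_add_eq_0_iff bit_vec_add_eq_left_iff bit_vec_add_eq_right_iff)

lemma subspace_plane:
  assumes "x \<in> carrier_vec n" "y \<in> carrier_vec n"
  shows "subspace class_ring (plane n x y) (module_vec TYPE(bit) n)"
proof -
  have "y + (x + y) = x" "x + y + x = y" "x + y + y = x" "y + x = x + y"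
    using assms bit_vec_add_left_cancel[of y n x] bit_vec_add_left_cancel[of x n y]
    by (metis add_carrier_vec comm_add_vec)+
  then show ?thesis
    using assms unfolding subspace_bit_iff plane_def
    by (auto simp: bit_vec_add_self bit_vec_add_left_cancel)
qed

text \<open>Both directions count: dimension 2 means exactly four codewords, since
  \<open>2 ^ dim\<close> determines the dimension.\<close>

lemma two_dim_subspace_iff_plane:
  "subspace class_ring C (module_vec TYPE(bit) n) \<and>
   vectorspace.dim class_ring ((module_vec TYPE(bit) n)\<lparr>carrier := C\<rparr>) = 2 \<longleftrightarrow>
   (\<exists>x y. independent_pair n x y \<and> C = plane n x y)" (is "?L \<longleftrightarrow> ?R")
proof
  assume L: ?L
  then have card: "card C = 4" and sub: "C \<subseteq> carrier_vec n" "0\<^sub>v n \<in> C"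
    and add: "\<And>v w. v \<in> C \<Longrightarrow> w \<in> C \<Longrightarrow> v + w \<in> C"
    using card_bit_subspace[of C n] by (auto simp: subspace_bit_iff)
  \<comment> \<open>Any two of the three nonzero codewords serve as a basis; the plane they span
    lies in \<open>C\<close> and also has four elements.\<close>
  have "card (C - {0\<^sub>v n}) = 3" using card sub(2) by simp
  then obtain x y z where xyz: "C - {0\<^sub>v n} = {x, y, z}" "x \<noteq> y"
    by (auto simp: card_3_iff)
  then have C: "x \<in> C" "y \<in> C" "x \<noteq> 0\<^sub>v n" "y \<noteq> 0\<^sub>v n" by blast+
  then have ind: "independent_pair n x y"
    using sub xyz by (auto simp: independent_pair_def)
  have "plane n x y \<subseteq> C" using C add sub by (auto simp: plane_def)
  moreover have "card (plane n x y) = 4"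
    using plane_minus_zero[OF ind] ind
    by (auto simp: plane_def independent_pair_def card_insert_if)
  moreover have "finite C" using card by (simp add: card_ge_0_finite)
  ultimately have "plane n x y = C" using card by (intro card_subset_eq) auto
  then show ?R using ind by blast
next
  assume ?R
  then obtain x y where xy: "independent_pair n x y" "C = plane n x y" by blast
  then have sub: "subspace class_ring C (module_vec TYPE(bit) n)"
    by (simp add: subspace_plane independent_pair_def)
  have "card C = 2 ^ 2"
    using plane_minus_zero[OF xy(1)] xy
    by (auto simp: plane_def independent_pair_def card_insert_if)
  then have "(2::nat) ^ vectorspace.dim class_ring ((module_vec TYPE(bit) n)\<lparr>carrier := C\<rparr>) = 2 ^ 2"
    using card_bit_subspace[OF sub] by simp
  then show ?L using sub by (subst (asm) power_inject_exp) auto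
qed

section \<open>Column counts, weights and the LCD criterion\<close>

definition column_count :: "bit vec \<Rightarrow> bit vec \<Rightarrow> bit \<Rightarrow> bit \<Rightarrow> nat" where
  "column_count x y u v = card {i. i < dim_vec x \<and> x $ i = u \<and> y $ i = v}"

lemma card_split_bit:
  assumes "finite A"
  shows "card A = card {i\<in>A. f i = (0::bit)} + card {i\<in>A. f i = 1}"
proof -
  have "card ({i\<in>A. f i = 0} \<union> {i\<in>A. f i = 1}) = card {i\<in>A. f i = 0} + card {i\<in>A. f i = 1}"
    by (rule card_Un_disjoint) (use assms in auto)
  moreover have "{i\<in>A. f i = 0} \<union> {i\<in>A. f i = 1} = A" by auto
  ultimately show ?thesis by simp
qed

lemma weights_eq_column_counts:
  assumes "x \<in> carrier_vec n" "y \<in> carrier_vec n"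
  shows "hamming_weight x = column_count x y 1 0 + column_count x y 1 1"
    and "hamming_weight y = column_count x y 0 1 + column_count x y 1 1"
    and "hamming_weight (x + y) = column_count x y 1 0 + column_count x y 0 1"
    and "n = column_count x y 0 0 + column_count x y 0 1
           + column_count x y 1 0 + column_count x y 1 1"
proof -
  show "hamming_weight x = column_count x y 1 0 + column_count x y 1 1"
    using assms card_split_bit[of "{i. i < n \<and> x $ i \<noteq> 0}" "($) y"]
    by (simp add: hamming_weight_def column_count_def conj_ac)
  show "hamming_weight y = column_count x y 0 1 + column_count x y 1 1"
    using assms card_split_bit[of "{i. i < n \<and> y $ i \<noteq> 0}" "($) x"]
    by (simp add: hamming_weight_def column_count_def conj_ac)
  \<comment> \<open>The support of \<open>x + y\<close> consists of the positions where
    \<open>x\<close> and \<open>y\<close> differ.\<close>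
  have "{i. i < n \<and> (x + y) $ i \<noteq> 0} =
      {i. i < n \<and> x $ i = 1 \<and> y $ i = 0} \<union> {i. i < n \<and> x $ i = 0 \<and> y $ i = 1}"
    (is "_ = ?A \<union> ?B")
    using assms by (auto simp: bit_add_self)
  moreover have "card (?A \<union> ?B) = card ?A + card ?B"
    by (rule card_Un_disjoint) auto
  ultimately show "hamming_weight (x + y) = column_count x y 1 0 + column_count x y 0 1"
    using assms unfolding hamming_weight_def column_count_def by simp
  show "n = column_count x y 0 0 + column_count x y 0 1
          + column_count x y 1 0 + column_count x y 1 1"
    using assms card_split_bit[of "{i. i < n}" "($) x"]
      card_split_bit[of "{i. i < n \<and> x $ i = 0}" "($) y"]
      card_split_bit[of "{i. i < n \<and> x $ i = 1}" "($) y"]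
    by (simp add: column_count_def conj_ac)
qed

lemma scalar_prod_bit_eq_column_count:
  assumes "x \<in> carrier_vec n" "y \<in> carrier_vec n"
  shows "x \<bullet> y = of_nat (column_count x y 1 1)"
proof -
  have "x \<bullet> y = (\<Sum>i<n. if x $ i = 1 \<and> y $ i = 1 then 1 else 0)"
    using assms by (auto simp: scalar_prod_def lessThan_atLeast0 intro!: sum.cong)
  also have "\<dots> = of_nat (card ({..<n} \<inter> {i. x $ i = 1 \<and> y $ i = 1}))"
    by (simp add: sum.If_cases)
  also have "{..<n} \<inter> {i. x $ i = 1 \<and> y $ i = 1} = {i. i < dim_vec x \<and> x $ i = 1 \<and> y $ i = 1}"
    using assms by auto
  finally show ?thesis by (simp add: column_count_def)
qed

lemma of_nat_bit_eq_0_iff: "of_nat k = (0::bit) \<longleftrightarrow> even k"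
  by (induction k) (auto)

text \<open>The three conjuncts exclude \<open>x + y\<close>, \<open>x\<close> and \<open>y\<close>,
  in this order, from the dual. Modulo 2 the inner products of \<open>x\<close> with
  \<open>x\<close> and \<open>y\<close> are \<open>a + c\<close> and \<open>c\<close>, those of
  \<open>y\<close> are \<open>c\<close> and \<open>b + c\<close>, and those of \<open>x + y\<close>
  are \<open>a\<close> and \<open>b\<close>.\<close>

lemma plane_inter_dual_iff:
  assumes "independent_pair n x y"
  defines "a \<equiv> column_count x y 1 0" and "b \<equiv> column_count x y 0 1" and "c \<equiv> column_count x y 1 1"
  shows "plane n x y \<inter> dual_code n (plane n x y) = {0\<^sub>v n} \<longleftrightarrow>
     \<not> (even a \<and> even b) \<and> \<not> (even a \<and> even c) \<and> \<not> (even b \<and> even c)"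
proof -
  have car: "x \<in> carrier_vec n" "y \<in> carrier_vec n"
    using assms(1) by (auto simp: independent_pair_def)
  \<comment> \<open>Pairing \<open>v\<close> with itself, the columns (1, 1) are exactly the support
    of \<open>v\<close>.\<close>
  have self: "v \<bullet> v = of_nat (hamming_weight v)" if "v \<in> carrier_vec n" for v
    using scalar_prod_bit_eq_column_count[OF that that]
    by (simp add: hamming_weight_def column_count_def)
  have xx: "x \<bullet> x = of_nat (a + c)" and yy: "y \<bullet> y = of_nat (b + c)"
    using self car weights_eq_column_counts[OF car] by (simp_all add: a_def b_def c_def)
  have xy: "x \<bullet> y = of_nat c" "y \<bullet> x = of_nat c"
    using scalar_prod_bit_eq_column_count[OF car] comm_scalar_prod[OF car] by (simp_all add: c_def)
  have dual: "v \<in> dual_code n (plane n x y) \<longleftrightarrow> v \<bullet> x = 0 \<and> v \<bullet> y = 0"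
    if "v \<in> carrier_vec n" for v
    using that car by (auto simp: dual_code_def plane_def scalar_prod_add_distrib[of v n])
  have "plane n x y \<inter> dual_code n (plane n x y) = {0\<^sub>v n} \<longleftrightarrow>
    (\<forall>v\<in>{x, y, x + y}. v \<notin> dual_code n (plane n x y))"
  proof -
    have "0\<^sub>v n \<in> plane n x y \<inter> dual_code n (plane n x y)"
      using car by (subst Int_iff, subst dual) (auto simp: plane_def)
    then show ?thesis
      using plane_minus_zero(1)[OF assms(1)] by blast
  qed
  also have "\<dots> \<longleftrightarrow> \<not> (even (a + c) \<and> even c) \<and> \<not> (even c \<and> even (b + c)) \<and>
      \<not> (even (a + c + c) \<and> even (c + (b + c)))"
    using car by (simp add: dual add_scalar_prod_distrib[of x n] xx yy xy of_nat_bit_eq_0_iff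
        flip: of_nat_add)
  also have "\<dots> \<longleftrightarrow> \<not> (even a \<and> even b) \<and> \<not> (even a \<and> even c) \<and> \<not> (even b \<and> even c)"
    by auto
  finally show ?thesis .
qed

text \<open>The invariant that will classify the codes. A multiset is needed because different
  codewords may have the same weight.\<close>

definition weights :: "nat \<Rightarrow> bit vec set \<Rightarrow> nat multiset" where
  "weights n C = image_mset hamming_weight (mset_set (C - {0\<^sub>v n}))"

lemma weights_plane:
  assumes "independent_pair n x y"
  shows "weights n (plane n x y) = {#hamming_weight x, hamming_weight y, hamming_weight (x + y)#}"
  using plane_minus_zero[OF assms] by (simp add: weights_def)

lemma min_weight_plane:
  assumes "independent_pair n x y"
  shows "min_weight n (plane n x y) =
    Min {hamming_weight x, hamming_weight y, hamming_weight (x + y)}"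
  using plane_minus_zero[OF assms] by (simp add: min_weight_def)

lemma LCD_codes_two_iff:
  "C \<in> LCD_codes n 2 d \<longleftrightarrow> (\<exists>x y. independent_pair n x y \<and> C = plane n x y \<and>
     Min {hamming_weight x, hamming_weight y, hamming_weight (x + y)} = d \<and>
     plane n x y \<inter> dual_code n (plane n x y) = {0\<^sub>v n})"
proof -
  have "C \<in> LCD_codes n 2 d \<longleftrightarrow> (\<exists>x y. independent_pair n x y \<and> C = plane n x y) \<and>
      C \<noteq> {0\<^sub>v n} \<and> min_weight n C = d \<and> C \<inter> dual_code n C = {0\<^sub>v n}"
    unfolding two_dim_subspace_iff_plane[symmetric] LCD_codes_def linear_code_def by simp
  moreover have "plane n x y \<noteq> {0\<^sub>v n}" if "independent_pair n x y" for x y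
    using that by (auto simp: plane_def independent_pair_def)
  ultimately show ?thesis
    using min_weight_plane by metis
qed

section \<open>Coordinate permutations and equivalence\<close>

lemma permute_coords_add:
  assumes "p permutes {..<n}" "x \<in> carrier_vec n" "y \<in> carrier_vec n"
  shows "permute_coords p (x + y) = permute_coords p x + permute_coords p y"
  using assms permutes_in_image[OF assms(1)] by (intro eq_vecI) (auto simp: permute_coords_def)

lemma permute_coords_zero:
  assumes "p permutes {..<n}"
  shows "permute_coords p (0\<^sub>v n) = 0\<^sub>v n"
  using assms permutes_in_image[OF assms(1)] by (intro eq_vecI) (auto simp: permute_coords_def)

lemma hamming_weight_permute_coords:
  assumes "p permutes {..<n}" "v \<in> carrier_vec n"
  shows "hamming_weight (permute_coords p v) = hamming_weight v"
proof -
  have "bij_betw p {i. i < n \<and> v $ p i \<noteq> 0} {i. i < n \<and> v $ i \<noteq> 0}"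
    using permutes_in_image[OF assms(1)] permutes_inj[OF assms(1)] permutes_surj[OF assms(1)]
    by (auto simp: bij_betw_def inj_on_def image_iff dest: injD) (metis lessThan_iff surjD)
  from bij_betw_same_card[OF this] show ?thesis
    using assms by (simp add: hamming_weight_def permute_coords_def cong: conj_cong)
qed

lemma permute_coords_plane:
  assumes "p permutes {..<n}" "x \<in> carrier_vec n" "y \<in> carrier_vec n"
  shows "permute_coords p ` plane n x y = plane n (permute_coords p x) (permute_coords p y)"
  using assms by (simp add: plane_def permute_coords_add permute_coords_zero)

text \<open>Swapping the basis vectors and the shear of \<open>plane_shear\<close> together reach
  all six ordered bases of the plane.\<close>

lemma plane_swap:
  assumes "independent_pair n x y"
  shows "plane n y x = plane n x y" "independent_pair n y x"
proof -
  have "y + x = x + y"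
    using assms comm_add_vec[of x n y] by (simp add: independent_pair_def)
  then show "plane n y x = plane n x y" by (auto simp: plane_def)
  show "independent_pair n y x" using assms by (auto simp: independent_pair_def)
qed

lemma plane_shear:
  assumes "independent_pair n x y"
  shows "plane n x (x + y) = plane n x y" "independent_pair n x (x + y)"
proof -
  have "x + (x + y) = y"
    using assms bit_vec_add_left_cancel[of x n y] by (simp add: independent_pair_def)
  then show "plane n x (x + y) = plane n x y" by (auto simp: plane_def)
  show "independent_pair n x (x + y)"
    using assms plane_minus_zero(2)[OF assms] by (auto simp: independent_pair_def bit_vec_add_eq_0_iff)
qed

text \<open>The three weights and the length form a linear system that determines all four column
  counts. Two pairs with the same number of columns of each type differ by a rearrangement of
  columns.\<close>

lemma ex_permutation_of_equal_weights:
  assumes car: "x \<in> carrier_vec n" "y \<in> carrier_vec n" "x' \<in> carrier_vec n" "y' \<in> carrier_vec n"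
    and wt: "hamming_weight x = hamming_weight x'" "hamming_weight y = hamming_weight y'"
      "hamming_weight (x + y) = hamming_weight (x' + y')"
  obtains p where "p permutes {..<n}" "x' = permute_coords p x" "y' = permute_coords p y"
proof -
  have "column_count x y u v = column_count x' y' u v" for u v
    using weights_eq_column_counts[OF car(1,2)] weights_eq_column_counts[OF car(3,4)] wt
    by (cases u; cases v; hypsubst) linarith+
  then have "card {i. i < n \<and> x $ i = u \<and> y $ i = v} = card {i. i < n \<and> x' $ i = u \<and> y' $ i = v}"
    for u v using car by (simp add: column_count_def)
  \<comment> \<open>Equality of the multisets of columns yields a single \<open>p\<close> that works
    for both vectors at once.\<close>
  then have "image_mset (\<lambda>i. (x' $ i, y' $ i)) (mset_set {..<n}) =
      image_mset (\<lambda>i. (x $ i, y $ i)) (mset_set {..<n})"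
    by (auto simp: multiset_eq_iff count_image_mset' eq_commute[of _ "_ $ _"])
  then obtain p where p: "p permutes {..<n}" "\<forall>i\<in>{..<n}. (x' $ i, y' $ i) = (x $ p i, y $ p i)"
    by (rule image_mset_eq_implies_permutes[OF finite_lessThan])
  show ?thesis
    using p car by (intro that[of p]) (auto simp: permute_coords_def)
qed

lemma mset_pair_eq_cases:
  assumes "{#a, b#} = {#p, q#}"
  shows "a = p \<and> b = q \<or> a = q \<and> b = p"
proof -
  have "a \<in># {#p, q#}" unfolding assms[symmetric] by simp
  then consider "a = p" | "a = q" by auto
  then show ?thesis
  proof cases
    case 1
    then show ?thesis using assms by simp
  next
    case 2
    then have "add_mset q {#b#} = add_mset q {#p#}"
      using assms by (metis add_mset_commute)
    then show ?thesis using 2 by simp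
  qed
qed

text \<open>Turns an equality of weight multisets into one of the six matchings of their
  entries.\<close>

lemma mset_triple_eq_cases:
  assumes "{#a, b, c#} = {#p, q, r#}"
  shows "a = p \<and> b = q \<and> c = r \<or> a = q \<and> b = p \<and> c = r \<or> a = p \<and> b = r \<and> c = q \<or>
    a = r \<and> b = p \<and> c = q \<or> a = q \<and> b = r \<and> c = p \<or> a = r \<and> b = q \<and> c = p"
proof -
  have "a \<in># {#p, q, r#}" unfolding assms[symmetric] by simp
  then consider "a = p" | "a = q" | "a = r" by auto
  then show ?thesis
  proof cases
    case 1
    then have "{#b, c#} = {#q, r#}" using assms by simp
    from mset_pair_eq_cases[OF this] show ?thesis using 1 by blast
  next
    case 2
    then have "add_mset q {#b, c#} = add_mset q {#p, r#}"
      using assms by (metis add_mset_commute)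
    then have "{#b, c#} = {#p, r#}" by simp
    from mset_pair_eq_cases[OF this] show ?thesis using 2 by blast
  next
    case 3
    have "add_mset r {#b, c#} = add_mset r {#p, q#}"
      using assms 3 by (metis add_mset_commute)
    then have "{#b, c#} = {#p, q#}" by simp
    from mset_pair_eq_cases[OF this] show ?thesis using 3 by blast
  qed
qed

text \<open>A permutation acts injectively, fixes 0 and preserves weights. Conversely, equal weight
  multisets allow the basis of the second code to be chosen so that weights agree vector by vector,
  and then the columns can be rearranged.\<close>

lemma code_equiv_plane_iff:
  assumes ind: "independent_pair n x y" "independent_pair n x' y'"
  shows "(plane n x y, plane n x' y') \<in> code_equiv n \<longleftrightarrow>
    weights n (plane n x y) = weights n (plane n x' y')" (is "?L \<longleftrightarrow> ?R")
proof
  have car: "x \<in> carrier_vec n" "y \<in> carrier_vec n" "x' \<in> carrier_vec n" "y' \<in> carrier_vec n"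
    using ind by (auto simp: independent_pair_def)
  {
    assume ?L
    then obtain p where p: "p permutes {..<n}" "plane n x' y' = permute_coords p ` plane n x y"
      by (auto simp: code_equiv_def)
    have sub: "plane n x y \<subseteq> carrier_vec n"
      using car by (auto simp: plane_def)
    have "inj_on (permute_coords p) (plane n x y)"
    proof (rule inj_on_inverseI[of _ "permute_coords (inv_into UNIV p)"])
      fix v assume "v \<in> plane n x y"
      then have "v \<in> carrier_vec n" using sub by blast
      then show "permute_coords (inv_into UNIV p) (permute_coords p v) = v"
        by (simp only: permute_coords_comp[OF _ permutes_inv[OF p(1)]] permutes_inv_o[OF p(1)]
            permute_coords_id)
    qed
    moreover from this have "plane n x' y' - {0\<^sub>v n} = permute_coords p ` (plane n x y - {0\<^sub>v n})"
      using p permute_coords_zero[OF p(1)]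
      by (subst inj_on_image_set_diff[of _ "plane n x y"]) (auto simp: plane_def)
    ultimately have "mset_set (plane n x' y' - {0\<^sub>v n}) =
        image_mset (permute_coords p) (mset_set (plane n x y - {0\<^sub>v n}))"
      by (simp add: image_mset_mset_set inj_on_diff)
    then show ?R
      using hamming_weight_permute_coords[OF p(1)] sub
      by (auto simp: weights_def plane_def multiset.map_comp intro!: image_mset_cong)
  }
  {
    assume ?R
    then have eq: "{#hamming_weight x, hamming_weight y, hamming_weight (x + y)#} =
        {#hamming_weight x', hamming_weight y', hamming_weight (x' + y')#}"
      using ind by (simp add: weights_plane)
    \<comment> \<open>Each of the six matchings of weights is realised by one of the six ordered
      bases of the second plane.\<close>
    have "\<exists>u v. independent_pair n u v \<and> plane n u v = plane n x' y' \<and>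
      hamming_weight x = hamming_weight u \<and> hamming_weight y = hamming_weight v \<and>
      hamming_weight (x + y) = hamming_weight (u + v)" (is "\<exists>u v. ?P u v")
    proof -
      let ?z = "x' + y'"
      have sums: "y' + x' = ?z" "x' + ?z = y'" "y' + ?z = x'" "?z + x' = y'" "?z + y' = x'"
        using car bit_vec_add_left_cancel[of x' n y'] bit_vec_add_left_cancel[of y' n x']
        by (metis add_carrier_vec comm_add_vec)+
      have gen: "independent_pair n u v \<and> plane n u v = plane n x' y'"
        if "(u, v) \<in> {(x', y'), (y', x'), (x', ?z), (?z, x'), (y', ?z), (?z, y')}" for u v
        using that ind(2) plane_swap plane_shear[OF ind(2)] plane_shear[OF plane_swap(2)[OF ind(2)]]
        unfolding sums by auto
      have pick: ?thesis
        if "(u, v) \<in> {(x', y'), (y', x'), (x', ?z), (?z, x'), (y', ?z), (?z, y')}"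
          and "hamming_weight x = hamming_weight u" "hamming_weight y = hamming_weight v"
            "hamming_weight (x + y) = hamming_weight (u + v)" for u v
        using gen[OF that(1)] that(2-4) by (intro exI[of _ u] exI[of _ v]) simp
      from mset_triple_eq_cases[OF eq] show ?thesis
      proof (elim disjE, goal_cases)
        case 1
        then show ?case by (intro pick[of "x'" "y'"]) (simp_all add: sums)
      next
        case 2
        then show ?case by (intro pick[of "y'" "x'"]) (simp_all add: sums)
      next
        case 3
        then show ?case by (intro pick[of "x'" "?z"]) (simp_all add: sums)
      next
        case 4
        then show ?case by (intro pick[of "?z" "x'"]) (simp_all add: sums)
      next
        case 5
        then show ?case by (intro pick[of "y'" "?z"]) (simp_all add: sums)
      next
        case 6
        then show ?case by (intro pick[of "?z" "y'"]) (simp_all add: sums)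
      qed
    qed
    then obtain u v where uv: "?P u v" by blast
    then obtain p where p: "p permutes {..<n}" "u = permute_coords p x" "v = permute_coords p y"
      using ex_permutation_of_equal_weights[of x n y u v] car by (auto simp: independent_pair_def)
    then have "plane n x' y' = permute_coords p ` plane n x y"
      using uv car by (simp add: permute_coords_plane)
    then show ?L
      using p car by (auto simp: code_equiv_def plane_def)
  }
qed

section \<open>Counting classes by their weight multisets\<close>

lemma card_quotient_eq_card_image:
  assumes "equiv B r" "A \<subseteq> B" "\<And>u v. u \<in> A \<Longrightarrow> v \<in> A \<Longrightarrow> (u, v) \<in> r \<longleftrightarrow> f u = f v"
  shows "card (A // r) = card (f ` A)"
proof -
  have cls: "r `` {u} = r `` {v} \<longleftrightarrow> f u = f v" if "u \<in> A" "v \<in> A" for u v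
    using assms that eq_equiv_class_iff[OF assms(1)] by blast
  have img: "f ` (A \<inter> r `` {u}) = {f u}" if "u \<in> A" for u
    using that assms equiv_class_self[OF assms(1)] by fastforce
  \<comment> \<open>Classes are taken in all of \<open>B\<close> and \<open>f\<close> is controlled
    only on \<open>A\<close>, hence the intersection. Each class is sent to the singleton of its
    common value of \<open>f\<close>.\<close>
  have "inj_on (\<lambda>X. f ` (A \<inter> X)) (A // r)"
    using cls img by (auto simp: inj_on_def quotient_def)
  then have "card (A // r) = card ((\<lambda>X. f ` (A \<inter> X)) ` (A // r))"
    by (simp add: card_image)
  also have "(\<lambda>X. f ` (A \<inter> X)) ` (A // r) = (\<lambda>y. {y}) ` f ` A"
    using img by (auto simp: quotient_def image_iff)
  also have "card \<dots> = card (f ` A)"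
    by (simp add: card_image inj_on_def)
  finally show ?thesis .
qed

lemma num_LCD_codes_two_eq: "num_LCD_codes n 2 d = card (weights n ` LCD_codes n 2 d)"
  unfolding num_LCD_codes_def
proof (rule card_quotient_eq_card_image[OF equiv_code_equiv])
  show "LCD_codes n 2 d \<subseteq> Pow (carrier_vec n)"
    by (auto simp: LCD_codes_two_iff plane_def independent_pair_def)
next
  fix C D assume "C \<in> LCD_codes n 2 d" "D \<in> LCD_codes n 2 d"
  then show "(C, D) \<in> code_equiv n \<longleftrightarrow> weights n C = weights n D"
    unfolding LCD_codes_two_iff using code_equiv_plane_iff by blast
qed

section \<open>Realisable weight multisets\<close>

lemma ex_columns:
  assumes "a + b + c \<le> n"
  obtains x y where "x \<in> carrier_vec n" "y \<in> carrier_vec n"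
    "column_count x y 1 0 = a" "column_count x y 0 1 = b" "column_count x y 1 1 = c"
proof -
  \<comment> \<open>The columns come in consecutive blocks: \<open>a\<close> of type (1, 0), then
    \<open>c\<close> of type (1, 1), then \<open>b\<close> of type (0, 1), and zero columns up to
    length \<open>n\<close>.\<close>
  let ?x = "vec n (\<lambda>i. if i < a + c then 1 else 0 :: bit)"
  let ?y = "vec n (\<lambda>i. if a \<le> i \<and> i < a + c + b then 1 else 0 :: bit)"
  have "{i. i < dim_vec ?x \<and> ?x $ i = 1 \<and> ?y $ i = 0} = {..<a}"
    "{i. i < dim_vec ?x \<and> ?x $ i = 0 \<and> ?y $ i = 1} = {a + c..<a + c + b}"
    "{i. i < dim_vec ?x \<and> ?x $ i = 1 \<and> ?y $ i = 1} = {a..<a + c}"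
    using assms by (auto split: if_splits)
  then show ?thesis
    by (intro that[of ?x ?y]) (simp_all add: column_count_def)
qed

lemma weights_LCD_codes_two:
  assumes "d > 0"
  shows "weights n ` LCD_codes n 2 d = {{#a + c, b + c, a + b#} | a b c. a + b + c \<le> n \<and>
     Min {a + c, b + c, a + b} = d \<and>
     \<not> (even a \<and> even b) \<and> \<not> (even a \<and> even c) \<and> \<not> (even b \<and> even c)}" (is "_ = ?R")
proof
  show "weights n ` LCD_codes n 2 d \<subseteq> ?R"
  proof
    fix w assume "w \<in> weights n ` LCD_codes n 2 d"
    then obtain x y where xy: "independent_pair n x y" "w = weights n (plane n x y)"
      "Min {hamming_weight x, hamming_weight y, hamming_weight (x + y)} = d"
      "plane n x y \<inter> dual_code n (plane n x y) = {0\<^sub>v n}"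
      by (auto simp: LCD_codes_two_iff simp del: Min_insert)
    then have car: "x \<in> carrier_vec n" "y \<in> carrier_vec n"
      by (auto simp: independent_pair_def)
    have "column_count x y 1 0 + column_count x y 0 1 + column_count x y 1 1 \<le> n"
      using weights_eq_column_counts(4)[OF car] by linarith
    then show "w \<in> ?R"
      using xy weights_plane[OF xy(1)] plane_inter_dual_iff[OF xy(1)]
      unfolding weights_eq_column_counts(1-3)[OF car] by blast
  qed
next
  show "?R \<subseteq> weights n ` LCD_codes n 2 d"
  proof
    fix w assume "w \<in> ?R"
    then obtain a b c where w: "w = {#a + c, b + c, a + b#}" "a + b + c \<le> n"
      "Min {a + c, b + c, a + b} = d"
      and odd: "\<not> (even a \<and> even b) \<and> \<not> (even a \<and> even c) \<and> \<not> (even b \<and> even c)"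
      by blast
    obtain x y where car: "x \<in> carrier_vec n" "y \<in> carrier_vec n" and cc:
      "column_count x y 1 0 = a" "column_count x y 0 1 = b" "column_count x y 1 1 = c"
      using ex_columns[OF w(2)] .
    note wt = weights_eq_column_counts(1-3)[OF car, unfolded cc]
    have pos: "a + c > 0" "b + c > 0" "a + b > 0" using w(3) assms by auto
    have zero: "hamming_weight (0\<^sub>v n) = 0" by (simp add: hamming_weight_def)
    \<comment> \<open>Independence follows from \<open>d > 0\<close>: all three weights are
      positive, whereas \<open>x = y\<close> would give \<open>x + y\<close> weight 0.\<close>
    have "x \<noteq> 0\<^sub>v n" "y \<noteq> 0\<^sub>v n" using wt pos zero by auto
    moreover have "x \<noteq> y" using wt pos zero bit_vec_add_self[OF car(1)] by auto
    ultimately have ind: "independent_pair n x y"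
      using car by (auto simp: independent_pair_def)
    then have "plane n x y \<in> LCD_codes n 2 d"
      unfolding LCD_codes_two_iff using w(3) wt plane_inter_dual_iff[OF ind] cc odd
      by (intro exI[of _ x] exI[of _ y]) simp
    moreover have "w = weights n (plane n x y)"
      using weights_plane[OF ind] wt w(1) by simp
    ultimately show "w \<in> weights n ` LCD_codes n 2 d" by blast
  qed
qed

lemma sorted_triple_cases:
  fixes a b c :: nat
  obtains p q r where "p \<le> q" "q \<le> r" "{#p, q, r#} = {#a, b, c#}"
proof -
  define xs where "xs = sort [a, b, c]"
  have xs: "sorted xs" "mset xs = {#a, b, c#}" "length xs = Suc (Suc (Suc 0))"
    by (simp_all only: xs_def sorted_sort mset_sort length_sort) simp_all
  from xs(3) obtain p q r where "xs = [p, q, r]"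
    by (auto simp: length_Suc_conv)
  with xs(1,2) show ?thesis by (intro that[of p q r]) simp_all
qed

text \<open>Length bound, parity condition and multiset of pair sums are symmetric in
  \<open>a\<close>, \<open>b\<close>, \<open>c\<close>, so the triple may be sorted; the smallest
  pair sum is then \<open>a + b\<close>.\<close>

lemma weights_LCD_codes_two_sorted:
  assumes "d > 0"
  shows "weights n ` LCD_codes n 2 d = {{#a + b, a + c, b + c#} | a b c. a \<le> b \<and> b \<le> c \<and>
     a + b = d \<and> a + b + c \<le> n \<and> \<not> (even a \<and> even b) \<and> \<not> (even a \<and> even c) \<and> \<not> (even b \<and> even c)}"
  (is "_ = ?R")
proof
  show "weights n ` LCD_codes n 2 d \<subseteq> ?R"
  proof
    fix w assume "w \<in> weights n ` LCD_codes n 2 d"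
    then obtain a b c where w: "w = {#a + c, b + c, a + b#}" "a + b + c \<le> n"
      "Min {a + c, b + c, a + b} = d"
      "\<not> (even a \<and> even b)" "\<not> (even a \<and> even c)" "\<not> (even b \<and> even c)"
      unfolding weights_LCD_codes_two[OF assms] by blast
    obtain p q r where pqr: "p \<le> q" "q \<le> r" "{#p, q, r#} = {#a, b, c#}"
      by (rule sorted_triple_cases)
    from mset_triple_eq_cases[OF pqr(3)]
    have "w = {#p + q, p + r, q + r#} \<and> p + q = d \<and> p + q + r \<le> n \<and>
      \<not> (even p \<and> even q) \<and> \<not> (even p \<and> even r) \<and> \<not> (even q \<and> even r)"
      using w pqr(1,2) by (elim disjE conjE; hypsubst_thin) (auto simp: add_mset_commute add.commute)
    then show "w \<in> ?R" using pqr(1,2) by blast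
  qed
  show "?R \<subseteq> weights n ` LCD_codes n 2 d"
  proof
    fix w assume "w \<in> ?R"
    then obtain a b c where w: "w = {#a + b, a + c, b + c#}" "a \<le> b" "b \<le> c" "a + b = d"
      "a + b + c \<le> n" "\<not> (even a \<and> even b)" "\<not> (even a \<and> even c)" "\<not> (even b \<and> even c)"
      by blast
    have "w = {#a + c, b + c, a + b#}" using w(1) by (simp add: add_mset_commute)
    moreover have "Min {a + c, b + c, a + b} = d" using w by auto
    ultimately show "w \<in> weights n ` LCD_codes n 2 d"
      unfolding weights_LCD_codes_two[OF assms] using w(5-8) by blast
  qed
qed

text \<open>For sorted triples the pair sums are listed in increasing order, so they agree entry by
  entry, and three pair sums determine the three numbers.\<close>

lemma sorted_triple_eq_of_pair_sums_eq:
  fixes a b c p q r :: nat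
  assumes "{#a + b, a + c, b + c#} = {#p + q, p + r, q + r#}"
    and "a \<le> b" "b \<le> c" "p \<le> q" "q \<le> r"
  shows "a = p \<and> b = q \<and> c = r"
  using mset_triple_eq_cases[OF assms(1)] assms(2-5) by (elim disjE conjE) linarith+

section \<open>Enumerating the sorted triples\<close>

definition lcd_triples :: "nat \<Rightarrow> nat \<Rightarrow> (nat \<times> nat \<times> nat) set" where
  "lcd_triples n d = {(a, b, c). a \<le> b \<and> b \<le> c \<and> a + b = d \<and> a + b + c \<le> n \<and>
     \<not> (even a \<and> even b) \<and> \<not> (even a \<and> even c) \<and> \<not> (even b \<and> even c)}"

lemma num_LCD_codes_two_eq_card_triples:
  assumes "d > 0"
  shows "num_LCD_codes n 2 d = card (lcd_triples n d)"
proof -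
  let ?f = "\<lambda>(a, b, c). {#a + b, a + c, b + c#} :: nat multiset"
  have "weights n ` LCD_codes n 2 d = ?f ` lcd_triples n d"
    unfolding weights_LCD_codes_two_sorted[OF assms] lcd_triples_def
    by (fastforce simp: image_iff)
  moreover have "inj_on ?f (lcd_triples n d)"
  proof (rule inj_onI)
    fix u v assume uv: "u \<in> lcd_triples n d" "v \<in> lcd_triples n d" "?f u = ?f v"
    obtain a b c p q r where eq: "u = (a, b, c)" "v = (p, q, r)"
      by (metis prod_cases3)
    have "a = p \<and> b = q \<and> c = r"
      using uv(1,2) uv(3)[unfolded eq prod.case] unfolding eq
      by (intro sorted_triple_eq_of_pair_sums_eq) (simp_all only: lcd_triples_def mem_Collect_eq prod.case)
    then show "u = v" by (simp add: eq)
  qed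
  ultimately show ?thesis
    by (simp only: num_LCD_codes_two_eq card_image)
qed

text \<open>The length bound gives \<open>c \<le> 2 * t + 2\<close>, and \<open>b\<close> lies
  between half of \<open>a + b\<close> and \<open>c\<close>. The choice \<open>b = 2 * t + 2\<close>
  makes \<open>a = 2 * t\<close> even as well, against the parity condition.\<close>

lemma lcd_triples_6t_plus_4:
  "lcd_triples (6 * t + 4) (4 * t + 2) =
     {(2 * t + 1, 2 * t + 1, 2 * t + 1), (2 * t + 1, 2 * t + 1, 2 * t + 2)}" (is "?T = ?S")
proof
  have "(a, b, c) \<in> ?S" if "(a, b, c) \<in> ?T" for a b c
  proof -
    have abc: "a \<le> b" "b \<le> c" "a + b = 4 * t + 2" "c \<le> 2 * t + 2" "\<not> (even a \<and> even b)"
      using that by (simp_all add: lcd_triples_def)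
    then consider "b = 2 * t + 1" | "b = 2 * t + 2" by linarith
    then show ?thesis
    proof cases
      case 1
      then have "c = 2 * t + 1 \<or> c = 2 * t + 2" "a = 2 * t + 1" using abc by linarith+
      then show ?thesis using 1 by auto
    next
      case 2
      then have "a = 2 * t" using abc by linarith
      then show ?thesis using 2 abc by simp
    qed
  qed
  then show "?T \<subseteq> ?S" by (simp add: subset_iff)
qed (simp add: lcd_triples_def)

text \<open>The extra coordinate raises the bound to \<open>c \<le> 2 * t + 3\<close>. This adds a
  third value of \<open>c\<close> for \<open>a = b\<close>, and the new case
  \<open>b = c = 2 * t + 3\<close>.\<close>

lemma lcd_triples_6t_plus_5:
  assumes "t \<ge> 1"
  shows "lcd_triples (6 * t + 5) (4 * t + 2) =
     {(2 * t + 1, 2 * t + 1, 2 * t + 1), (2 * t + 1, 2 * t + 1, 2 * t + 2),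
      (2 * t + 1, 2 * t + 1, 2 * t + 3), (2 * t - 1, 2 * t + 3, 2 * t + 3)}" (is "?T = ?S")
proof
  have "(a, b, c) \<in> ?S" if "(a, b, c) \<in> ?T" for a b c
  proof -
    have abc: "a \<le> b" "b \<le> c" "a + b = 4 * t + 2" "c \<le> 2 * t + 3" "\<not> (even a \<and> even b)"
      using that by (simp_all add: lcd_triples_def)
    then consider "b = 2 * t + 1" | "b = 2 * t + 2" | "b = 2 * t + 3" by linarith
    then show ?thesis
    proof cases
      case 1
      then have "c = 2 * t + 1 \<or> c = 2 * t + 2 \<or> c = 2 * t + 3" "a = 2 * t + 1"
        using abc by linarith+
      then show ?thesis using 1 by auto
    next
      case 2
      then have "a = 2 * t" using abc by linarith
      then show ?thesis using 2 abc by simp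
    next
      case 3
      then have "c = 2 * t + 3" "a = 2 * t - 1" using abc by linarith+
      then show ?thesis using 3 by simp
    qed
  qed
  then show "?T \<subseteq> ?S" by (simp add: subset_iff)
  \<comment> \<open>With \<open>t = Suc s\<close> the truncated difference \<open>2 * t - 1\<close>
    is a genuine odd number. For \<open>t = 0\<close> the fourth triple would be (0, 3, 3), whose
    first two entries do not sum to 2.\<close>
  obtain s where "t = Suc s" using assms by (cases t) auto
  then show "?S \<subseteq> ?T" by (simp add: lcd_triples_def)
qed

theorem theorem4p8:
  shows "(\<forall>t::nat. num_LCD_codes (6 * t + 4) 2 (4 * t + 2) = 2) \<and>
         (\<forall>t::nat. t \<ge> 1 \<longrightarrow> num_LCD_codes (6 * t + 5) 2 (4 * t + 2) = 4)"
proof (intro conjI allI impI)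
  fix t :: nat
  show "num_LCD_codes (6 * t + 4) 2 (4 * t + 2) = 2"
    by (subst num_LCD_codes_two_eq_card_triples) (simp, unfold lcd_triples_6t_plus_4, simp)
next
  fix t :: nat assume t: "t \<ge> 1"
  show "num_LCD_codes (6 * t + 5) 2 (4 * t + 2) = 4"
    by (subst num_LCD_codes_two_eq_card_triples) (simp, unfold lcd_triples_6t_plus_5[OF t], simp)
qed

end
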